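(* Let $\mathbb{D}$ be a division ring and $K\ge 1$ an integer, with the component index $k$ understood modulo $K$. The non-commutative lattice modified Gel'fand--Dikii system $$(r_{k(j)}^{-1}-r_{k(i)}^{-1})\,r_{k(ij)} = r_{k+1}^{-1}\,(r_{k+1(i)}-r_{k+1(j)}),\qquad k=1,\dots,K,\quad i\neq j,$$ is three-dimensionally consistent. Explicitly: let $i,j,l$ be three distinct directions and let $r_k, r_{k(i)}, r_{k(j)}, r_{k(l)}\in\mathbb{D}^\times$ ($k=1,\dots,K$) be given such that, for each $k$, the elements $r_{k(i)},r_{k(j)},r_{k(l)}$ are pairwise distinct. For distinct $a,b\in\{i,j,l\}$ define $$r_{k(ab)}=(r_{k(b)}^{-1}-r_{k(a)}^{-1})^{-1}\,r_{k+1}^{-1}\,(r_{k+1(a)}-r_{k+1(b)})$$ (this is symmetric in $a,b$), and assume that for each $k$ the elements $r_{k(ij)},r_{k(il)},r_{k(jl)}$ are pairwise distinct. Then for each $k$ the three elements $$[r_{k(ab)}]_{(c)} := (r_{k(bc)}^{-1}-r_{k(ac)}^{-1})^{-1}\,r_{k+1(c)}^{-1}\,(r_{k+1(ac)}-r_{k+1(bc)}),\qquad \{a,b,c\}=\{i,j,l\},$$ obtained by applying the system on the three shifted faces, coincide: $[r_{k(ij)}]_{(l)}=[r_{k(il)}]_{(j)}=[r_{k(jl)}]_{(i)}$.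
   Context: For a function $f$ on $\mathbb{Z}^N$, $f_{(i)}$ denotes the translate $n_i\mapsto n_i+1$, and $f_{(ij)}=(f_{(i)})_{(j)}$. The unknowns of the system are functions $r_1,\dots,r_K:\mathbb{Z}^N\to\mathbb{D}^\times=\mathbb{D}\setminus\{0\}$. Three-dimensional consistency means that on an elementary cube of $\mathbb{Z}^3$, given generic values at a vertex and at its three neighbours, the values at the vertices with two shifts are determined by the system on the three faces containing the initial vertex, and the three ways to calculate the values at the opposite vertex (using the system on the three other faces) give the same result. "Generic" means that all expressions occurring are defined. *)

theory Defs
  imports Main
begin

text \<open>A field value at a lattice vertex is a \<open>K\<close>-tuple \<open>u :: nat \<Rightarrow> 'a\<close> of which only the
  components \<open>u k\<close> with \<open>k < K\<close> matter; \<open>0, \<dots>, K - 1\<close> represent the residues modulo \<open>K\<close>.\<close>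

text \<open>The lattice modified Gel'fand--Dikii system on one elementary face: \<open>u\<close> is the value at a
  vertex, \<open>ua\<close>, \<open>ub\<close> the values at its neighbours in directions \<open>a\<close>, \<open>b\<close>, and \<open>uab\<close> the value
  at the opposite vertex of the face. The system on the whole lattice requires this at every
  face.\<close>

definition gd_face ::
  "nat \<Rightarrow> (nat \<Rightarrow> 'a::division_ring) \<Rightarrow> (nat \<Rightarrow> 'a) \<Rightarrow> (nat \<Rightarrow> 'a) \<Rightarrow> (nat \<Rightarrow> 'a) \<Rightarrow> bool" where
  "gd_face K u ua ub uab \<longleftrightarrow>
     (\<forall>k<K. (inverse (ub k) - inverse (ua k)) * uab k
            = inverse (u (Suc k mod K)) * (ua (Suc k mod K) - ub (Suc k mod K)))"

definition gd_solve ::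
  "nat \<Rightarrow> (nat \<Rightarrow> 'a::division_ring) \<Rightarrow> (nat \<Rightarrow> 'a) \<Rightarrow> (nat \<Rightarrow> 'a) \<Rightarrow> nat \<Rightarrow> 'a" where
  "gd_solve K u ua ub k =
     inverse (inverse (ub k) - inverse (ua k)) * inverse (u (Suc k mod K))
       * (ua (Suc k mod K) - ub (Suc k mod K))"

text \<open>Below, \<open>r k\<close> is the value at the initial vertex and \<open>rs a k\<close> the value
  \<open>r\<^bsub>k(a)\<^esub>\<close> at its neighbour in direction \<open>a\<close>. Then \<open>gd_shift2 K r rs a b k\<close>
  is \<open>r\<^bsub>k(ab)\<^esub>\<close>, and \<open>gd_shift3 K r rs a b c k\<close> is \<open>[r\<^bsub>k(ab)\<^esub>]\<^bsub>(c)\<^esub>\<close>,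
  computed on the face shifted in direction \<open>c\<close>.\<close>

definition gd_shift2 ::
  "nat \<Rightarrow> (nat \<Rightarrow> 'a::division_ring) \<Rightarrow> ('d \<Rightarrow> nat \<Rightarrow> 'a) \<Rightarrow> 'd \<Rightarrow> 'd \<Rightarrow> nat \<Rightarrow> 'a" where
  "gd_shift2 K r rs a b = gd_solve K r (rs a) (rs b)"

definition gd_shift3 ::
  "nat \<Rightarrow> (nat \<Rightarrow> 'a::division_ring) \<Rightarrow> ('d \<Rightarrow> nat \<Rightarrow> 'a) \<Rightarrow> 'd \<Rightarrow> 'd \<Rightarrow> 'd \<Rightarrow> nat \<Rightarrow> 'a" where
  "gd_shift3 K r rs a b c =
     gd_solve K (rs c) (gd_shift2 K r rs a c) (gd_shift2 K r rs b c)"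

end

theory Submission
  imports Defs
begin

text \<open>Fix \<open>k\<close>. For points \<open>A, B, C\<close> and values \<open>x, y, z\<close> of a division ring, the
  expression \<open>(A - C)\<^sup>-\<^sup>1 (x - z) - (B - C)\<^sup>-\<^sup>1 (y - z)\<close> is \<open>A - B\<close> times a second-order
  left divided difference, which is symmetric in the three nodes. With the nodes
  \<open>r\<^bsub>k+1(a)\<^esub>, r\<^bsub>k+1(b)\<^esub>, r\<^bsub>k+1(c)\<^esub>\<close>, the two factors
  \<open>r\<^bsub>k(bc)\<^esub>\<^sup>-\<^sup>1 - r\<^bsub>k(ac)\<^esub>\<^sup>-\<^sup>1\<close> and
  \<open>r\<^bsub>k+1(c)\<^esub>\<^sup>-\<^sup>1 (r\<^bsub>k+1(ac)\<^esub> - r\<^bsub>k+1(bc)\<^esub>)\<close> are such expressions, for the values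
  \<open>r\<^bsub>k+1\<^esub> r\<^bsub>k(a)\<^esub>\<^sup>-\<^sup>1\<close> and \<open>r\<^bsub>k+1(a)\<^esub> r\<^bsub>k+2\<^esub>\<^sup>-\<^sup>1 r\<^bsub>k+2(a)\<^esub>\<close> respectively.
  Interchanging \<open>b\<close> and \<open>c\<close> therefore multiplies both factors on the left by the same element,
  which cancels in \<open>[r\<^bsub>k(ab)\<^esub>]\<^bsub>(c)\<^esub>\<close>.\<close>

definition divdiff :: "'a::division_ring \<Rightarrow> 'a \<Rightarrow> 'a \<Rightarrow> 'a \<Rightarrow> 'a \<Rightarrow> 'a \<Rightarrow> 'a" where
  "divdiff A B C x y z = inverse (A - C) * (x - z) - inverse (B - C) * (y - z)"

text \<open>Multiplying by \<open>A - C\<close> and splitting it as \<open>(A - B) + (B - C)\<close>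
  in front of the second summand gives the claim. The factor depends on the nodes alone, so it is
  the same for any two triples of values.\<close>

lemma divdiff_swap:
  fixes A B C :: "'a::division_ring"
  assumes "A \<noteq> B" "A \<noteq> C" "B \<noteq> C"
  shows "divdiff A C B x z y = inverse (A - B) * (A - C) * divdiff A B C x y z"
proof -
  define u v where "u = x - z" and "v = y - z"
  have P: "(A - C) * (inverse (A - C) * u) = u"
    using assms by (simp add: mult.assoc [symmetric])
  have PQ: "(A - C) * (inverse (A - C) * u - w) = u - (A - C) * w" for w
    by (simp only: right_diff_distrib P)
  have Q: "(B - C) * (inverse (B - C) * v) = v"
    using assms by (simp add: mult.assoc [symmetric])
  have R: "inverse (A - B) * ((A - B) * (inverse (B - C) * v)) = inverse (B - C) * v"
    using assms by (simp add: mult.assoc [symmetric])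
  have "(A - C) * (inverse (B - C) * v)
      = (A - B) * (inverse (B - C) * v) + (B - C) * (inverse (B - C) * v)"
    by (simp add: distrib_right [symmetric])
  then have "inverse (A - B) * ((A - C) * (inverse (B - C) * v))
      = inverse (B - C) * v + inverse (A - B) * v"
    by (simp only: Q distrib_left R)
  then have "inverse (A - B) * (A - C) * (inverse (A - C) * u - inverse (B - C) * v)
      = inverse (A - B) * (u - v) - inverse (B - C) * v"
    by (simp add: mult.assoc PQ right_diff_distrib [of "inverse (A - B)" u])
  moreover have "inverse (C - B) * (z - y) = inverse (B - C) * v"
    by (metis minus_diff_eq inverse_minus_eq minus_mult_minus v_def)
  ultimately show ?thesis
    by (simp add: divdiff_def u_def v_def)
qed

text \<open>Exchanging the neighbours reverses the sign of both differences, and the two signs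
  cancel.\<close>

lemma gd_solve_sym: "gd_solve K u ua ub k = gd_solve K u ub ua k"
proof -
  have "inverse (inverse (ub k) - inverse (ua k)) = - inverse (inverse (ua k) - inverse (ub k))"
    by (metis minus_diff_eq inverse_minus_eq)
  then show ?thesis
    by (simp add: gd_solve_def right_diff_distrib)
qed

lemma gd_solve_nonzero:
  assumes "k < K" "\<forall>k<K. u k \<noteq> 0" "\<forall>k<K. ua k \<noteq> ub k"
  shows "gd_solve K u ua ub k \<noteq> 0"
proof -
  have "Suc k mod K < K" using assms(1) by simp
  then show ?thesis
    using assms by (auto simp: gd_solve_def)
qed

text \<open>Distinct components of \<open>ua\<close> and \<open>ub\<close> make the coefficient of
  \<open>v k\<close> invertible. This ties the closed formula to the lattice equation.\<close>

lemma gd_face_iff_gd_solve: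
  assumes "\<forall>k<K. ua k \<noteq> ub k"
  shows "gd_face K u ua ub v \<longleftrightarrow> (\<forall>k<K. v k = gd_solve K u ua ub k)"
proof -
  have *: "d * x = y \<longleftrightarrow> x = inverse d * y" if "d \<noteq> 0" for d x y :: 'a
    using that by (metis left_inverse right_inverse mult.assoc mult_1_left)
  have "inverse (ub k) - inverse (ua k) \<noteq> 0" if "k < K" for k
    using assms that by auto
  then show ?thesis
    by (simp add: gd_face_def gd_solve_def * mult.assoc)
qed

text \<open>Inversion reverses the product: for \<open>f\<close> either \<open>ua\<close> or
  \<open>ub\<close>, \<open>inverse (f m - uc m)\<close> moves to the far left, and
  \<open>u m\<close> times the difference of inverses becomes, up to sign, a difference of values at
  two nodes.\<close>

lemma inverse_gd_solve_diff:
  fixes u ua ub uc :: "nat \<Rightarrow> 'a::division_ring"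
  assumes "k < K" "\<forall>k<K. u k \<noteq> 0" "\<forall>k<K. ua k \<noteq> uc k" "\<forall>k<K. ub k \<noteq> uc k"
  defines "m \<equiv> Suc k mod K"
  shows "inverse (gd_solve K u ub uc k) - inverse (gd_solve K u ua uc k)
    = divdiff (ua m) (ub m) (uc m)
        (u m * inverse (ua k)) (u m * inverse (ub k)) (u m * inverse (uc k))"
proof -
  have m: "m < K" using assms(1) by (simp add: m_def)
  have inv: "inverse (gd_solve K u f uc k)
      = - (inverse (f m - uc m) * (u m * inverse (f k) - u m * inverse (uc k)))"
    if "\<forall>k<K. f k \<noteq> uc k" for f
  proof -
    define e d where "e = inverse (uc k) - inverse (f k)" and "d = f m - uc m"
    have "e \<noteq> 0" "d \<noteq> 0" "u m \<noteq> 0"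
      using that assms(1,2) m by (auto simp: e_def d_def)
    then have "inverse (inverse e * inverse (u m) * d) = inverse d * (u m * e)"
      by (simp add: nonzero_inverse_mult_distrib)
    then show ?thesis
      by (simp add: gd_solve_def m_def [symmetric] e_def d_def right_diff_distrib [of "u m"]
          right_diff_distrib [of "inverse (f m - uc m)"])
  qed
  show ?thesis
    by (simp add: inv [OF assms(3)] inv [OF assms(4)] divdiff_def)
qed

lemma gd_solve_diff:
  fixes u ua ub uc :: "nat \<Rightarrow> 'a::division_ring"
  assumes "m < K" "\<forall>k<K. ua k \<noteq> uc k" "\<forall>k<K. ub k \<noteq> uc k"
    and "ua m \<noteq> 0" "ub m \<noteq> 0" "uc m \<noteq> 0"
  defines "n \<equiv> Suc m mod K"
  shows "inverse (uc m) * (gd_solve K u ua uc m - gd_solve K u ub uc m)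
    = divdiff (ua m) (ub m) (uc m) (ua m * inverse (u n) * ua n)
        (ub m * inverse (u n) * ub n) (uc m * inverse (u n) * uc n)"
proof -
  have cancel: "inverse d * (p - d * q) = inverse d * p - q" if "d \<noteq> 0" for d p q :: 'a
    using that by (simp add: right_diff_distrib mult.assoc [symmetric])
  have S: "inverse (uc m) * gd_solve K u f uc m
      = inverse (f m - uc m) * (f m * inverse (u n) * f n - uc m * inverse (u n) * uc n)
        - inverse (u n) * uc n"
    if f: "f m \<noteq> uc m" "f m \<noteq> 0" for f
  proof -
    \<comment> \<open>Both sides equal \<open>1 - inverse (f m) * uc m\<close>. Inverting them
      trades the difference of inverses for a difference of nodes.\<close>
    have "(inverse (uc m) - inverse (f m)) * uc m = inverse (f m) * (f m - uc m)"
      using f assms(6) by (simp add: algebra_simps)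
    then have "inverse ((inverse (uc m) - inverse (f m)) * uc m) = inverse (inverse (f m) * (f m - uc m))"
      by simp
    then have "inverse (uc m) * inverse (inverse (uc m) - inverse (f m)) = inverse (f m - uc m) * f m"
      using f assms(6) by (simp add: nonzero_inverse_mult_distrib)
    then have "inverse (uc m) * gd_solve K u f uc m
        = inverse (f m - uc m) * f m * (inverse (u n) * (f n - uc n))"
      by (simp add: gd_solve_def n_def mult.assoc [symmetric])
    \<comment> \<open>Rewriting \<open>f m * inverse (u n) * (f n - uc n)\<close> as a difference of
      values at the two nodes leaves a correction with left factor \<open>f m - uc m\<close>, which
      the inverse cancels.\<close>
    also have "\<dots> = inverse (f m - uc m) * (f m * inverse (u n) * f n - uc m * inverse (u n) * uc n
        - (f m - uc m) * (inverse (u n) * uc n))"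
      by (simp add: algebra_simps)
    also have "\<dots> = inverse (f m - uc m) * (f m * inverse (u n) * f n - uc m * inverse (u n) * uc n)
        - inverse (u n) * uc n"
      using f by (intro cancel) simp
    finally show ?thesis .
  qed
  \<comment> \<open>The leftover term \<open>inverse (u n) * uc n\<close> does not involve
    \<open>f\<close>, so it drops out of the difference.\<close>
  show ?thesis
    using S [of ua] S [of ub] assms by (simp add: right_diff_distrib [of "inverse (uc m)"] divdiff_def)
qed

lemma gd_shift2_sym: "gd_shift2 K r rs a b = gd_shift2 K r rs b a"
  unfolding gd_shift2_def using gd_solve_sym by blast

lemma gd_shift3_sym: "gd_shift3 K r rs a b c = gd_shift3 K r rs b a c"
  unfolding gd_shift3_def using gd_solve_sym by blast

lemma gd_shift3_swap:
  fixes r :: "nat \<Rightarrow> 'a::division_ring"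
  assumes "k < K" "\<forall>k<K. r k \<noteq> 0"
    and nz: "\<forall>k<K. rs a k \<noteq> 0" "\<forall>k<K. rs b k \<noteq> 0" "\<forall>k<K. rs c k \<noteq> 0"
    and ne: "\<forall>k<K. rs a k \<noteq> rs b k" "\<forall>k<K. rs a k \<noteq> rs c k" "\<forall>k<K. rs b k \<noteq> rs c k"
    and ne2: "\<forall>k<K. gd_shift2 K r rs a c k \<noteq> gd_shift2 K r rs b c k"
  shows "gd_shift3 K r rs a b c k = gd_shift3 K r rs a c b k"
proof -
  define m n where "m = Suc k mod K" and "n = Suc m mod K"
  have m: "m < K" using assms(1) by (simp add: m_def)
  \<comment> \<open>The factor from \<open>divdiff_swap\<close>. Its nodes are those of both
    \<open>D\<close> and \<open>N\<close>, which therefore share it.\<close>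
  define g where "g = inverse (rs a m - rs b m) * (rs a m - rs c m)"
  define D N where
    "D b c = divdiff (rs a m) (rs b m) (rs c m)
        (r m * inverse (rs a k)) (r m * inverse (rs b k)) (r m * inverse (rs c k))" and
    "N b c = divdiff (rs a m) (rs b m) (rs c m) (rs a m * inverse (r n) * rs a n)
        (rs b m * inverse (r n) * rs b n) (rs c m * inverse (r n) * rs c n)" for b c
  have shift3: "gd_shift3 K r rs a b' c' k = inverse (D b' c') * N b' c'"
    and D: "D b' c' = inverse (gd_shift2 K r rs b' c' k) - inverse (gd_shift2 K r rs a c' k)"
    if "b' = b \<and> c' = c \<or> b' = c \<and> c' = b" for b' c'
  proof -
    have *: "\<forall>k<K. rs a k \<noteq> rs c' k" "\<forall>k<K. rs b' k \<noteq> rs c' k"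
      using that ne by auto
    have **: "rs a m \<noteq> 0" "rs b' m \<noteq> 0" "rs c' m \<noteq> 0"
      using that nz m by auto
    show D: "D b' c' = inverse (gd_shift2 K r rs b' c' k) - inverse (gd_shift2 K r rs a c' k)"
      using inverse_gd_solve_diff [OF assms(1,2) *] by (simp add: D_def gd_shift2_def m_def)
    have "N b' c' = inverse (rs c' m) * (gd_shift2 K r rs a c' m - gd_shift2 K r rs b' c' m)"
      using gd_solve_diff [OF m * **] by (simp add: N_def gd_shift2_def n_def)
    with D show "gd_shift3 K r rs a b' c' k = inverse (D b' c') * N b' c'"
      by (simp add: gd_shift3_def gd_solve_def m_def mult.assoc)
  qed
  have ne_m: "rs a m \<noteq> rs b m" "rs a m \<noteq> rs c m" "rs b m \<noteq> rs c m"
    using ne m by auto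
  have g: "g \<noteq> 0" using ne_m by (simp add: g_def)
  have "D c b = g * D b c" "N c b = g * N b c"
    unfolding D_def N_def g_def by (rule divdiff_swap [OF ne_m])+
  \<comment> \<open>By \<open>ne2\<close>, \<open>D b c\<close> is a difference of inverses of
    distinct elements. Hence \<open>inverse (g * D b c)\<close> splits with \<open>inverse g\<close>
    on the right, next to the \<open>g\<close> of \<open>N c b\<close>.\<close>
  moreover have "D b c \<noteq> 0"
    using D [of b c] ne2 assms(1) by auto
  ultimately have "inverse (D c b) * N c b = inverse (D b c) * (inverse g * (g * N b c))"
    using g by (simp add: nonzero_inverse_mult_distrib mult.assoc)
  also have "inverse g * (g * N b c) = N b c"
    using g by (simp add: mult.assoc [symmetric])
  finally have "inverse (D c b) * N c b = inverse (D b c) * N b c" .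
  then show ?thesis by (simp add: shift3)
qed

theorem theorem2p2:
  fixes K :: nat
    and r :: "nat \<Rightarrow> 'a::division_ring"
    and rs :: "'d \<Rightarrow> nat \<Rightarrow> 'a"
    and i j l :: 'd
  assumes "K \<ge> 1"
    and "distinct [i, j, l]"
    and "\<forall>k<K. r k \<noteq> 0"
    and "\<forall>a\<in>{i, j, l}. \<forall>k<K. rs a k \<noteq> 0"
    and "\<forall>k<K. distinct [rs i k, rs j k, rs l k]"
    and "\<forall>k<K. distinct [gd_shift2 K r rs i j k, gd_shift2 K r rs i l k, gd_shift2 K r rs j l k]"
  shows
    "(\<forall>a\<in>{i, j, l}. \<forall>b\<in>{i, j, l}. a \<noteq> b \<longrightarrow>
       (\<forall>v. gd_face K r (rs a) (rs b) v \<longleftrightarrow> (\<forall>k<K. v k = gd_shift2 K r rs a b k)) \<and>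
       (\<forall>k<K. gd_shift2 K r rs a b k \<noteq> 0 \<and> gd_shift2 K r rs a b k = gd_shift2 K r rs b a k)) \<and>
     (\<forall>a b c. {a, b, c} = {i, j, l} \<longrightarrow>
       (\<forall>v. gd_face K (rs c) (gd_shift2 K r rs a c) (gd_shift2 K r rs b c) v
              \<longleftrightarrow> (\<forall>k<K. v k = gd_shift3 K r rs a b c k)) \<and>
       (\<forall>k<K. gd_shift3 K r rs a b c k \<noteq> 0)) \<and>
     (\<forall>k<K. gd_shift3 K r rs i j l k = gd_shift3 K r rs i l j k \<and>
            gd_shift3 K r rs i l j k = gd_shift3 K r rs j l i k)"
proof -
  have sym: "gd_shift2 K r rs b a = gd_shift2 K r rs a b" for a b
    by (rule gd_shift2_sym)
  have r: "\<forall>k<K. r k \<noteq> 0" using assms by blast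
  have nz: "\<forall>k<K. rs a k \<noteq> 0" if "a \<in> {i, j, l}" for a
    using assms(4) that by blast
  have ne: "\<forall>k<K. rs a k \<noteq> rs b k" if "a \<in> {i, j, l}" "b \<in> {i, j, l}" "a \<noteq> b" for a b
    using assms(5) that by fastforce
  have ne2: "\<forall>k<K. gd_shift2 K r rs a c k \<noteq> gd_shift2 K r rs b c k"
    if "{a, b, c} = {i, j, l}" for a b c
  proof -
    \<comment> \<open>Since \<open>i\<close>, \<open>j\<close>, \<open>l\<close> are distinct, only
      the six permutations occur.\<close>
    have "a = i \<and> b = j \<and> c = l \<or> a = i \<and> b = l \<and> c = j \<or> a = j \<and> b = i \<and> c = l \<or>
        a = j \<and> b = l \<and> c = i \<or> a = l \<and> b = i \<and> c = j \<or> a = l \<and> b = j \<and> c = i"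
      using that assms(2) by (simp add: set_eq_iff) metis
    then show ?thesis
      using assms(6) by (auto simp: sym [of i j] sym [of i l] sym [of j l])
  qed
  have swap: "gd_shift3 K r rs a b c k = gd_shift3 K r rs a c b k"
    if "{a, b, c} = {i, j, l}" "distinct [a, b, c]" "k < K" for a b c k
  proof -
    have "a \<in> {i, j, l}" "b \<in> {i, j, l}" "c \<in> {i, j, l}" using that(1) by blast+
    then show ?thesis
      using that(2) by (intro gd_shift3_swap that(3) r nz ne ne2 that(1)) auto
  qed
  have consistent: "gd_shift3 K r rs i j l k = gd_shift3 K r rs i l j k"
      "gd_shift3 K r rs i l j k = gd_shift3 K r rs j l i k" if "k < K" for k
  proof -
    show "gd_shift3 K r rs i j l k = gd_shift3 K r rs i l j k"
      using assms(2) that by (intro swap) auto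
    \<comment> \<open>A swap keeps the first direction, so \<open>l\<close> is put first; symmetry
      in the first two directions then restores the required order.\<close>
    have "gd_shift3 K r rs l i j k = gd_shift3 K r rs l j i k"
      using assms(2) that by (intro swap) auto
    then show "gd_shift3 K r rs i l j k = gd_shift3 K r rs j l i k"
      by (simp add: gd_shift3_sym [of K r rs l])
  qed
  have face3: "(\<forall>v. gd_face K (rs c) (gd_shift2 K r rs a c) (gd_shift2 K r rs b c) v
        \<longleftrightarrow> (\<forall>k<K. v k = gd_shift3 K r rs a b c k)) \<and>
      (\<forall>k<K. gd_shift3 K r rs a b c k \<noteq> 0)" if "{a, b, c} = {i, j, l}" for a b c
  proof -
    have "c \<in> {i, j, l}" using that by blast
    then show ?thesis
      using ne2 [OF that] nz [of c]
      by (simp add: gd_face_iff_gd_solve gd_solve_nonzero gd_shift3_def)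
  qed
  have face2: "(\<forall>v. gd_face K r (rs a) (rs b) v \<longleftrightarrow> (\<forall>k<K. v k = gd_shift2 K r rs a b k)) \<and>
      (\<forall>k<K. gd_shift2 K r rs a b k \<noteq> 0 \<and> gd_shift2 K r rs a b k = gd_shift2 K r rs b a k)"
    if "a \<in> {i, j, l}" "b \<in> {i, j, l}" "a \<noteq> b" for a b
    unfolding sym [of b a] unfolding gd_shift2_def
    using ne [OF that] r by (simp add: gd_face_iff_gd_solve gd_solve_nonzero)
  show ?thesis
    by (intro conjI [OF _ conjI] ballI allI impI)
      (rule face2 face3 conjI [OF consistent]; assumption)+
qed

end
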